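(* Let $G$ be a finite abelian group of order $N$. Then for any integer $s\ge 64\log_2^2 N$, the number of subsets of $G$ that can be expressed as a union of at most $k=\left\lfloor \frac{N}{2s\ln(eN/s)}\right\rfloor$ sumsets is at most $2^{N-s/8}+e^{N/2}$.
   Context: A sumset in $G$ is a set of the form $A+A=\{a+b : a,b\in A\}$ for some $A\subseteq G$ (with $a=b$ allowed).
   Formalization: The formal theorem adds the condition that s ≤ N whenever k ≥ 1; without it the claim is false, e.g. for G = Z_10001 and s = ⌊eN⌋, where k ≥ (N−1)/2 and at least 2^(N−1) sets are unions of at most k singleton sumsets. *)

theory Defs
  imports Complex_Main "HOL-Algebra.Coset"
begin

text \<open>The abelian group is written multiplicatively, as usual in HOL-Algebra,
  so the set \<open>A + A\<close> is \<open>A <#>\<^bsub>G\<^esub> A\<close>.\<close>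

definition is_sumset :: "('a, 'b) monoid_scheme \<Rightarrow> 'a set \<Rightarrow> bool" where
  "is_sumset G S \<longleftrightarrow> (\<exists>A. A \<subseteq> carrier G \<and> S = A <#>\<^bsub>G\<^esub> A)"

text \<open>The bound \<open>k\<close> is an integer because the floor defining it in the application may be
  negative; no set is a union of at most \<open>k\<close> sumsets if \<open>k < 0\<close>, and only the empty set is
  one if \<open>k = 0\<close>.\<close>

definition union_of_at_most_sumsets :: "('a, 'b) monoid_scheme \<Rightarrow> int \<Rightarrow> 'a set \<Rightarrow> bool" where
  "union_of_at_most_sumsets G k X \<longleftrightarrow>
     (\<exists>F. finite F \<and> int (card F) \<le> k \<and> (\<forall>S\<in>F. is_sumset G S) \<and> X = \<Union>F)"

end

theory Submission
  imports Defs
begin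

text \<open>
  Let \<open>X\<close> be the union of the sets \<open>A\<^sub>i + A\<^sub>i\<close>. If every \<open>A\<^sub>i\<close> has at most \<open>s\<close> elements, there
  are at most \<open>(eN/s)\<^bsup>sk\<^esup> \<le> e\<^bsup>N/2\<^esup>\<close> possibilities for \<open>X\<close>. Otherwise some \<open>A = A\<^sub>i\<close> has at least
  \<open>s\<close> elements, and a greedy choice gives \<open>B \<subseteq> A\<close> with \<open>|B| \<le> \<surd>s\<close> and \<open>|B + B| \<ge> s/4\<close>:
  as long as \<open>|B + B| < s/4\<close>, an average translate \<open>x + B\<close> with \<open>x \<in> A\<close> meets \<open>B + B\<close> in at most
  a quarter of its elements. Since \<open>X\<close> contains \<open>B + B\<close>, this second case accounts for at most
  \<open>N\<^bsup>\<surd>s\<^esup> 2\<^bsup>N - s/4\<^esup> \<le> 2\<^bsup>N - s/8\<^esup>\<close> sets.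
\<close>

section \<open>Counting small subsets, unions and supersets\<close>

text \<open>Turns "at most \<open>k\<close> members" into a family indexed by exactly
  \<open>{..<k}\<close>, so that functions can be counted instead of sets. Surplus indices repeat
  \<open>h 0\<close>, which exists because \<open>F\<close> is nonempty.\<close>

lemma finite_set_enumeration:
  assumes "finite F" and "F \<noteq> {}" and "card F \<le> k"
  obtains f :: "nat \<Rightarrow> 'a" where "f \<in> {..<k} \<rightarrow>\<^sub>E F" and "f ` {..<k} = F"
proof -
  obtain h where h: "bij_betw h {..<card F} F"
    using ex_bij_betw_nat_finite[OF assms(1)] by (auto simp: atLeast0LessThan)
  have pos: "0 < card F" using assms by (simp add: card_gt_0_iff)
  define f where "f = restrict (\<lambda>i. if i < card F then h i else h 0) {..<k}"
  have "f \<in> {..<k} \<rightarrow>\<^sub>E F"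
    using bij_betwE[OF h] pos by (auto simp: f_def)
  moreover have "F \<subseteq> f ` {..<k}"
  proof
    fix x assume "x \<in> F"
    then obtain i where "i < card F" "x = h i" using h by (auto simp: bij_betw_def)
    then show "x \<in> f ` {..<k}" using assms(3) by (intro image_eqI[of _ _ i]) (auto simp: f_def)
  qed
  ultimately show thesis using that by blast
qed

text \<open>Each such \<open>B\<close> is the range of a function from \<open>{..<b}\<close> to
  \<open>C\<close>, repetitions allowed. The empty set is left out because for \<open>b > 0\<close>
  it is no such range.\<close>

lemma card_nonempty_small_subsets_le:
  assumes "finite C"
  shows "card {B. B \<subseteq> C \<and> B \<noteq> {} \<and> card B \<le> b} \<le> card C ^ b"
proof -
  have "{B. B \<subseteq> C \<and> B \<noteq> {} \<and> card B \<le> b} \<subseteq> (\<lambda>f. f ` {..<b}) ` ({..<b} \<rightarrow>\<^sub>E C)"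
  proof
    fix B assume B: "B \<in> {B. B \<subseteq> C \<and> B \<noteq> {} \<and> card B \<le> b}"
    then have "finite B" using assms finite_subset by blast
    then obtain f where "f \<in> {..<b} \<rightarrow>\<^sub>E B" "f ` {..<b} = B"
      using finite_set_enumeration B by blast
    then show "B \<in> (\<lambda>f. f ` {..<b}) ` ({..<b} \<rightarrow>\<^sub>E C)" using B by blast
  qed
  then have "card {B. B \<subseteq> C \<and> B \<noteq> {} \<and> card B \<le> b} \<le> card ({..<b} \<rightarrow>\<^sub>E C)"
    by (rule surj_card_le[rotated]) (simp add: finite_PiE assms)
  then show ?thesis by (simp add: card_PiE)
qed

lemma card_small_subsets:
  assumes "finite C"
  shows "card {A. A \<subseteq> C \<and> card A \<le> m} = (\<Sum>j\<le>m. card C choose j)"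
proof -
  have "{A. A \<subseteq> C \<and> card A \<le> m} = (\<Union>j\<in>{..m}. {A. A \<subseteq> C \<and> card A = j})" by auto
  also have "card \<dots> = (\<Sum>j\<le>m. card {A. A \<subseteq> C \<and> card A = j})"
    using assms by (intro card_UN_disjoint) auto
  finally show ?thesis using assms by (simp add: n_subsets)
qed

text \<open>With the weight \<open>x = m / n \<le> 1\<close>, each \<open>x ^ m\<close> is at most
  \<open>x ^ j\<close> for \<open>j \<le> m\<close>, so \<open>x ^ m\<close> times the sum is at
  most \<open>(1 + x) ^ n \<le> exp 1 ^ m\<close>.\<close>

lemma sum_binomial_le:
  fixes n m :: nat
  assumes "1 \<le> m" and "m \<le> n"
  shows "real (\<Sum>j\<le>m. n choose j) \<le> (exp 1 * real n / real m) ^ m"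
proof -
  define x where "x = real m / real n"
  have x: "0 < x" "x \<le> 1" using assms by (auto simp: x_def)
  have "x ^ m * real (\<Sum>j\<le>m. n choose j) = (\<Sum>j\<le>m. real (n choose j) * x ^ m)"
    by (simp add: sum_distrib_left mult.commute)
  also have "\<dots> \<le> (\<Sum>j\<le>m. real (n choose j) * x ^ j)"
    using x by (intro sum_mono mult_left_mono power_decreasing) auto
  also have "\<dots> \<le> (\<Sum>j\<le>n. real (n choose j) * x ^ j)"
    using x assms by (intro sum_mono2) auto
  also have "\<dots> = (x + 1) ^ n" by (simp add: binomial_ring)
  also have "\<dots> \<le> exp x ^ n"
    using x by (intro power_mono) (auto simp: add.commute)
  also have "\<dots> = exp 1 ^ m"
    using assms by (simp add: x_def flip: exp_of_nat_mult)
  finally have "real (\<Sum>j\<le>m. n choose j) \<le> exp 1 ^ m / x ^ m"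
    using x by (simp add: field_simps)
  also have "\<dots> = (exp 1 * real n / real m) ^ m"
    by (simp add: x_def power_divide power_mult_distrib)
  finally show ?thesis .
qed

lemma card_supersets:
  assumes "finite C" and "D \<subseteq> C"
  shows "card {X. X \<subseteq> C \<and> D \<subseteq> X} = 2 ^ (card C - card D)"
proof -
  have "bij_betw (\<lambda>X. X - D) {X. X \<subseteq> C \<and> D \<subseteq> X} (Pow (C - D))"
    using assms(2) by (intro bij_betw_byWitness[where f' = "\<lambda>Y. Y \<union> D"]) auto
  then have "card {X. X \<subseteq> C \<and> D \<subseteq> X} = 2 ^ card (C - D)"
    using assms by (simp add: bij_betw_same_card card_Pow)
  then show ?thesis using assms by (simp add: card_Diff_subset finite_subset)
qed

section \<open>Product sets in a group\<close>

context group
begin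

text \<open>Double counting of the pairs \<open>(x, y)\<close> with
  \<open>x \<otimes> y \<in> S\<close>: by cancellation, each \<open>y\<close> in \<open>B\<close>
  belongs to at most \<open>card S\<close> of them.\<close>

lemma sum_card_translate_inter_le:
  assumes "finite A" "A \<subseteq> carrier G" "finite B" "B \<subseteq> carrier G" "finite S"
  shows "(\<Sum>x\<in>A. card ((x <# B) \<inter> S)) \<le> card B * card S"
proof -
  have "card ((x <# B) \<inter> S) = card {y\<in>B. x \<otimes> y \<in> S}" if "x \<in> A" for x
  proof -
    have "(x <# B) \<inter> S = (\<lambda>y. x \<otimes> y) ` {y\<in>B. x \<otimes> y \<in> S}"
      by (auto simp: l_coset_def)
    moreover have "inj_on (\<lambda>y. x \<otimes> y) {y\<in>B. x \<otimes> y \<in> S}"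
      using that assms by (intro inj_onI) (auto simp: subset_iff)
    ultimately show ?thesis by (simp add: card_image)
  qed
  then have "(\<Sum>x\<in>A. card ((x <# B) \<inter> S)) = (\<Sum>x\<in>A. card {y\<in>B. x \<otimes> y \<in> S})" by simp
  also have "\<dots> = (\<Sum>y\<in>B. card {x\<in>A. x \<otimes> y \<in> S})"
    using assms by (intro sum_multicount_gen) auto
  also have "\<dots> \<le> (\<Sum>y\<in>B. card S)"
  proof (rule sum_mono)
    fix y assume y: "y \<in> B"
    have "inj_on (\<lambda>x. x \<otimes> y) {x\<in>A. x \<otimes> y \<in> S}"
      using y assms by (intro inj_onI) (auto simp: subset_iff)
    then show "card {x\<in>A. x \<otimes> y \<in> S} \<le> card S"
      using assms by (intro card_inj_on_le) auto
  qed
  finally show ?thesis by simp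
qed

text \<open>Until the target \<open>s / 4\<close> is reached, enlarging \<open>B\<close> from
  \<open>j\<close> to \<open>j + 1\<close> elements adds at least \<open>3 * j / 4\<close> new
  products. Summing these gains gives \<open>3 * j * (j - 1) / 8\<close>. After that
  \<open>B\<close> is kept unchanged.\<close>

lemma greedy_large_product_set:
  assumes A: "finite A" "A \<subseteq> carrier G" and s: "1 \<le> s" "s \<le> card A"
  shows "\<exists>B\<subseteq>A. card B \<le> j \<and>
           (s \<le> 4 * card (B <#> B) \<or> card B = j \<and> 3 * j * (j - 1) \<le> 8 * card (B <#> B))"
proof (induction j)
  case 0
  show ?case by (intro exI[of _ "{}"]) auto
next
  case (Suc j)
  then obtain B where B: "B \<subseteq> A" "card B \<le> j"
    and disj: "s \<le> 4 * card (B <#> B) \<or> card B = j \<and> 3 * j * (j - 1) \<le> 8 * card (B <#> B)"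
    by blast
  show ?case
  proof (cases "s \<le> 4 * card (B <#> B)")
    case True
    then show ?thesis using B by (intro exI[of _ B]) auto
  next
    case False
    define S where "S = B <#> B"
    have cB: "card B = j" and cS: "3 * j * (j - 1) \<le> 8 * card S" and Ss: "4 * card S < s"
      using False disj by (auto simp: S_def)
    have finB: "finite B" and BG: "B \<subseteq> carrier G" using A B finite_subset by auto
    have finS: "finite S" using finB by (auto simp: S_def set_mult_def)
    have A_ne: "A \<noteq> {}" using s by auto
    \<comment> \<open>Averaging over \<open>A\<close>: the intersections have total size at most
      \<open>j * card S\<close>, and \<open>4 * card S < s \<le> card A\<close>.\<close>
    have "\<exists>x\<in>A. 4 * card ((x <# B) \<inter> S) \<le> j"
    proof (rule ccontr)
      assume "\<not> ?thesis"
      then have "(\<Sum>x\<in>A. j) < (\<Sum>x\<in>A. 4 * card ((x <# B) \<inter> S))"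
        using A A_ne by (intro sum_strict_mono) auto
      then have "j * card A < 4 * (\<Sum>x\<in>A. card ((x <# B) \<inter> S))"
        by (simp add: sum_distrib_left mult.commute)
      also have "\<dots> \<le> j * (4 * card S)"
        using sum_card_translate_inter_le[OF A finB BG finS] cB by simp
      also have "\<dots> \<le> j * card A" using Ss s by (intro mult_left_mono) auto
      finally show False by simp
    qed
    then obtain x where x: "x \<in> A" "4 * card ((x <# B) \<inter> S) \<le> j" by blast
    have xG: "x \<in> carrier G" using x A by auto
    have card_xB: "card (x <# B) = j"
    proof -
      have "x <# B = (\<lambda>y. x \<otimes> y) ` B" by (auto simp: l_coset_def)
      moreover have "inj_on (\<lambda>y. x \<otimes> y) B"
        using xG BG by (intro inj_onI) (auto simp: subset_iff)
      ultimately show ?thesis using cB by (simp add: card_image)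
    qed
    have fin_xB: "finite (x <# B)" using finB by (auto simp: l_coset_def)
    \<comment> \<open>For \<open>x\<close> in \<open>B\<close> the whole translate would lie in
      \<open>S\<close>, and \<open>4 * j \<le> j\<close> would force \<open>B\<close> to be
      empty.\<close>
    have "x \<notin> B"
    proof
      assume "x \<in> B"
      then have "(x <# B) \<inter> S = x <# B" by (auto simp: S_def l_coset_def set_mult_def)
      then have "j = 0" using x card_xB by simp
      then show False using cB finB \<open>x \<in> B\<close> by auto
    qed
    define B' where "B' = insert x B"
    have cB': "card B' = Suc j" using \<open>x \<notin> B\<close> finB cB by (simp add: B'_def)
    have fin': "finite (B' <#> B')" using finB by (auto simp: B'_def set_mult_def)
    have "S \<union> (x <# B) \<subseteq> B' <#> B'"
      by (auto simp: S_def B'_def set_mult_def l_coset_def)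
    then have "card (S \<union> (x <# B)) \<le> card (B' <#> B')"
      by (rule card_mono[OF fin'])
    moreover have "card S + j = card (S \<union> (x <# B)) + card ((x <# B) \<inter> S)"
      using card_Un_Int[OF finS fin_xB] card_xB by (simp add: Int_commute)
    ultimately have "8 * card S + 6 * j \<le> 8 * card (B' <#> B')" using x by linarith
    moreover have "3 * Suc j * (Suc j - 1) = 3 * j * (j - 1) + 6 * j"
      by (cases j) (auto simp: algebra_simps)
    ultimately have "3 * Suc j * (Suc j - 1) \<le> 8 * card (B' <#> B')" using cS by linarith
    then show ?thesis using cB' B x by (intro exI[of _ B']) (auto simp: B'_def)
  qed
qed

text \<open>The hypothesis on \<open>b\<close> makes the quadratic alternative of the greedy lemma
  imply the desired size as well.\<close>

lemma exists_small_subset_large_product_set: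
  assumes "A \<subseteq> carrier G" and "1 \<le> s" and "s \<le> card A"
    and "2 * s \<le> 3 * b * (b - 1)"
  shows "\<exists>B\<subseteq>A. card B \<le> b \<and> s \<le> 4 * card (B <#> B)"
proof -
  have "finite A" using assms card.infinite by fastforce
  then obtain B where "B \<subseteq> A" "card B \<le> b"
    and "s \<le> 4 * card (B <#> B) \<or> 3 * b * (b - 1) \<le> 8 * card (B <#> B)"
    using greedy_large_product_set[of A s b] assms by blast
  then show ?thesis using assms(4) by (intro exI[of _ B]) auto
qed

text \<open>Union bound: there are at most \<open>order G ^ b\<close> choices of \<open>B\<close>,
  and each fixes at least \<open>s / 4\<close> elements of \<open>X\<close>.\<close>

lemma card_supersets_of_large_product_sets_le:
  assumes fin: "finite (carrier G)" and s: "1 \<le> s"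
  shows "real (card {X. X \<subseteq> carrier G \<and> (\<exists>B\<subseteq>carrier G. card B \<le> b \<and>
                    s \<le> 4 * card (B <#> B) \<and> B <#> B \<subseteq> X)})
           \<le> real (order G) ^ b * 2 powr (real (order G) - real s / 4)"
proof -
  define \<B> where "\<B> = {B. B \<subseteq> carrier G \<and> card B \<le> b \<and> s \<le> 4 * card (B <#> B)}"
  define \<C> where "\<C> = {B. B \<subseteq> carrier G \<and> B \<noteq> {} \<and> card B \<le> b}"
  have fin\<C>: "finite \<C>" using fin by (simp add: \<C>_def)
  \<comment> \<open>Since \<open>1 \<le> s\<close>, the empty \<open>B\<close>, whose product set is
    empty, is excluded.\<close>
  have sub: "\<B> \<subseteq> \<C>" using s by (auto simp: \<B>_def \<C>_def set_mult_def)
  have fin\<B>: "finite \<B>" using sub fin\<C> finite_subset by blast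
  have card\<B>: "real (card \<B>) \<le> real (order G) ^ b"
  proof -
    have "card \<B> \<le> card \<C>" using sub fin\<C> by (rule card_mono[rotated])
    also have "\<dots> \<le> order G ^ b"
      using card_nonempty_small_subsets_le[OF fin] by (simp add: \<C>_def order_def)
    finally show ?thesis by (metis of_nat_le_iff of_nat_power)
  qed
  have "{X. X \<subseteq> carrier G \<and> (\<exists>B\<subseteq>carrier G. card B \<le> b \<and>
            s \<le> 4 * card (B <#> B) \<and> B <#> B \<subseteq> X)}
          = (\<Union>B\<in>\<B>. {X. X \<subseteq> carrier G \<and> B <#> B \<subseteq> X})" (is "?U = _")
    by (auto simp: \<B>_def)
  then have "card ?U \<le> (\<Sum>B\<in>\<B>. card {X. X \<subseteq> carrier G \<and> B <#> B \<subseteq> X})"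
    using card_UN_le[OF fin\<B>] by simp
  then have "real (card ?U) \<le> (\<Sum>B\<in>\<B>. real (card {X. X \<subseteq> carrier G \<and> B <#> B \<subseteq> X}))"
    by (simp only: flip: of_nat_sum of_nat_le_iff[where ?'a = real])
  also have "\<dots> \<le> (\<Sum>B\<in>\<B>. 2 powr (real (order G) - real s / 4))"
  proof (rule sum_mono)
    fix B assume "B \<in> \<B>"
    then have B: "B \<subseteq> carrier G" "s \<le> 4 * card (B <#> B)" by (auto simp: \<B>_def)
    have BB: "B <#> B \<subseteq> carrier G" using B by (intro set_mult_closed)
    then have le: "card (B <#> B) \<le> order G" using fin by (simp add: order_def card_mono)
    have "real (card {X. X \<subseteq> carrier G \<and> B <#> B \<subseteq> X})
            = 2 powr (real (order G) - real (card (B <#> B)))"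
      using card_supersets[OF fin BB] le
      by (simp add: order_def powr_realpow flip: of_nat_diff)
    also have "\<dots> \<le> 2 powr (real (order G) - real s / 4)"
      using B by (intro powr_mono) auto
    finally show "real (card {X. X \<subseteq> carrier G \<and> B <#> B \<subseteq> X})
                    \<le> 2 powr (real (order G) - real s / 4)" .
  qed
  also have "\<dots> \<le> real (order G) ^ b * 2 powr (real (order G) - real s / 4)"
    using card\<B> by (simp add: mult_right_mono)
  finally show ?thesis .
qed

text \<open>Each of the \<open>k\<close> sets is chosen in at most
  \<open>(e * order G / s) ^ s\<close> ways. The exponential form allows a direct comparison with
  the definition of \<open>k\<close> in the theorem.\<close>

lemma card_unions_of_small_product_sets_le:
  assumes fin: "finite (carrier G)" and s: "1 \<le> s" "s \<le> order G"
  shows "real (card ((\<lambda>f. \<Union>i<k. f i <#> f i) `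
             ({..<k} \<rightarrow>\<^sub>E {A. A \<subseteq> carrier G \<and> card A \<le> s})))
           \<le> exp (real k * (real s * ln (exp 1 * real (order G) / real s)))"
proof -
  define \<A> where "\<A> = {A. A \<subseteq> carrier G \<and> card A \<le> s}"
  have "finite \<A>" using fin by (simp add: \<A>_def)
  then have "card ((\<lambda>f. \<Union>i<k. f i <#> f i) ` ({..<k} \<rightarrow>\<^sub>E \<A>)) \<le> card \<A> ^ k"
    using card_image_le[OF finite_PiE[of "{..<k}" "\<lambda>_. \<A>"]] by (simp add: card_PiE)
  then have "real (card ((\<lambda>f. \<Union>i<k. f i <#> f i) ` ({..<k} \<rightarrow>\<^sub>E \<A>))) \<le> real (card \<A>) ^ k"
    by (simp only: flip: of_nat_power of_nat_le_iff[where ?'a = real])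
  also have "\<dots> \<le> ((exp 1 * real (order G) / real s) ^ s) ^ k"
    using sum_binomial_le[OF s] card_small_subsets[OF fin]
    by (intro power_mono) (auto simp: \<A>_def order_def intro!: sum_nonneg)
  also have "\<dots> = (exp (ln (exp 1 * real (order G) / real s)) ^ s) ^ k"
    using s by simp
  also have "\<dots> = exp (real k * (real s * ln (exp 1 * real (order G) / real s)))"
    by (simp only: exp_of_nat_mult)
  finally show ?thesis by (simp add: \<A>_def)
qed

lemma union_of_at_most_sumsets_cases:
  assumes X: "X \<subseteq> carrier G" "union_of_at_most_sumsets G (int k) X" and "1 \<le> k"
  obtains (small) "X \<in> (\<lambda>f. \<Union>i<k. f i <#> f i) ` ({..<k} \<rightarrow>\<^sub>E {A. A \<subseteq> carrier G \<and> card A \<le> s})"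
    | (large) A where "A \<subseteq> carrier G" "s \<le> card A" "A <#> A \<subseteq> X"
proof -
  obtain F where F: "finite F" "card F \<le> k" "\<forall>S\<in>F. is_sumset G S" "X = \<Union>F"
    using X by (auto simp: union_of_at_most_sumsets_def)
  obtain g where g: "\<forall>S\<in>F. g S \<subseteq> carrier G \<and> S = g S <#> g S"
    using bchoice[OF F(3)[unfolded is_sumset_def]] by blast
  show thesis
  proof (cases "\<exists>S\<in>F. s \<le> card (g S)")
    case True
    then show thesis using large F(4) g by (metis Sup_upper)
  next
    case False
    \<comment> \<open>For the empty union, the set \<open>{}\<close> with empty product set stands
      in, so that there is something to enumerate; this fits because
      \<open>1 \<le> k\<close>.\<close>
    define E where "E = (if F = {} then {{}} else g ` F)"
    have "finite E" "E \<noteq> {}" "card E \<le> k"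
      using F(1,2) \<open>1 \<le> k\<close> card_image_le[OF F(1), of g] by (auto simp: E_def)
    then obtain f where f: "f \<in> {..<k} \<rightarrow>\<^sub>E E" "f ` {..<k} = E"
      using finite_set_enumeration by blast
    have "E \<subseteq> {A. A \<subseteq> carrier G \<and> card A \<le> s}"
      using False g by (auto simp: E_def not_le)
    then have "f \<in> {..<k} \<rightarrow>\<^sub>E {A. A \<subseteq> carrier G \<and> card A \<le> s}" using f by blast
    moreover have "X = (\<Union>i<k. f i <#> f i)"
    proof -
      have "(\<Union>i<k. f i <#> f i) = (\<Union>A\<in>E. A <#> A)" using f(2) by blast
      also have "\<dots> = X" using F(4) g by (auto simp: E_def set_mult_def)
      finally show ?thesis by simp
    qed
    ultimately show thesis using small by blast
  qed
qed

end

section \<open>The bound for unions of sumsets\<close>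

theorem theorem5p1:
  fixes G :: "('a, 'b) monoid_scheme" and N :: nat and s k :: int
  assumes "comm_group G" and "finite (carrier G)" and "order G = N"
    and "real_of_int s \<ge> 64 * (log 2 (real N))\<^sup>2"
    and "k = \<lfloor>real N / (2 * real_of_int s * ln (exp 1 * real N / real_of_int s))\<rfloor>"
    and "k \<ge> 1 \<longrightarrow> s \<le> int N"
  shows "real (card {X. X \<subseteq> carrier G \<and> union_of_at_most_sumsets G k X})
           \<le> 2 powr (real N - real_of_int s / 8) + exp (real N / 2)"
proof (cases "1 \<le> k")
  case False
  \<comment> \<open>For \<open>k < 1\<close> at most the empty set is counted, and
    \<open>1 \<le> exp (N / 2)\<close>.\<close>
  have "F = {}" if "finite F" "int (card F) \<le> k" for F :: "'a set set"
  proof -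
    have "card F = 0" using that False by linarith
    then show ?thesis using that by simp
  qed
  then have "{X. X \<subseteq> carrier G \<and> union_of_at_most_sumsets G k X} \<subseteq> {{}}"
    unfolding union_of_at_most_sumsets_def by blast
  then have "card {X. X \<subseteq> carrier G \<and> union_of_at_most_sumsets G k X} \<le> card {{} :: 'a set}"
    by (intro card_mono) auto
  also have "real \<dots> \<le> exp (real N / 2)" by simp
  also have "\<dots> \<le> 2 powr (real N - real_of_int s / 8) + exp (real N / 2)" by simp
  finally show ?thesis by simp
next
  case True
  interpret comm_group G by fact
  define L where "L = ln (exp 1 * real N / real_of_int s)"
  have "0 \<le> real_of_int s"
    using assms(4) by (rule order_trans[rotated]) simp
  \<comment> \<open>For \<open>s = 0\<close> division by zero would give
    \<open>k = 0\<close>.\<close>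
  moreover have "s \<noteq> 0"
    using True assms(5) by auto
  ultimately have s1: "1 \<le> s" by linarith
  have sN: "s \<le> int N" using assms(6) True by simp
  have L1: "1 \<le> L"
  proof -
    have "exp 1 * 1 \<le> exp 1 * (real N / real_of_int s)"
      using s1 sN by (intro mult_left_mono) auto
    then show ?thesis
      using s1 sN by (simp add: L_def ln_ge_iff)
  qed
  have k_le: "real_of_int k \<le> real N / (2 * real_of_int s * L)"
    using assms(5) by (simp add: L_def)
  have kL: "real_of_int k * (real_of_int s * L) \<le> real N / 2"
    using k_le s1 L1 by (simp add: field_simps)
  \<comment> \<open>The factors \<open>k\<close>, \<open>s\<close> and \<open>L\<close> are all at
    least 1, while their product is at most \<open>N / 2\<close>.\<close>
  have N2: "2 \<le> N"
  proof (rule ccontr)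
    assume "\<not> 2 \<le> N"
    then have "N \<le> 1" by simp
    have "1 * (1 * 1) \<le> real_of_int k * (real_of_int s * L)"
      using True s1 L1 by (intro mult_mono) auto
    then show False using kL \<open>N \<le> 1\<close> by simp
  qed
  then have log1: "1 \<le> log 2 (real N)" by simp
  then have "1 \<le> (log 2 (real N))\<^sup>2" by simp
  then have s64: "64 \<le> s" using assms(4) by linarith
  define m where "m = nat s"
  have m: "s = int m" "64 \<le> m" "m \<le> N" using s64 sN by (auto simp: m_def)
  define b where "b = nat \<lfloor>sqrt (real m)\<rfloor>"
  have b_le: "real b \<le> sqrt (real m)" by (simp add: b_def)
  have b_gt: "sqrt (real m) < real b + 1" by (simp add: b_def)
  have "real m < (real b + 1)\<^sup>2"
    using power_strict_mono[OF b_gt, of 2] by simp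
  then have m_less: "m < (b + 1)\<^sup>2"
    by (metis of_nat_1 of_nat_add of_nat_less_iff of_nat_power)
  have "8 \<le> b"
  proof -
    have "sqrt 64 \<le> sqrt (real m)" using m by (intro real_sqrt_le_mono) simp
    moreover have "sqrt 64 = 8" by (rule real_sqrt_unique) auto
    ultimately have "8 \<le> \<lfloor>sqrt (real m)\<rfloor>" by (simp add: le_floor_iff)
    then show ?thesis unfolding b_def by linarith
  qed
  \<comment> \<open>This removes the truncated subtraction. From
    \<open>m \<le> b * b + 2 * b\<close> the next claim reduces to
    \<open>7 * b \<le> b * b\<close>.\<close>
  then obtain c where "b = c + 8" by (metis add.commute le_Suc_ex)
  then have mb: "2 * m \<le> 3 * b * (b - 1)"
    using m_less by (simp add: power2_eq_square algebra_simps)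
  define U where "U = (\<lambda>f. \<Union>i<nat k. f i <#>\<^bsub>G\<^esub> f i) `
    ({..<nat k} \<rightarrow>\<^sub>E {A. A \<subseteq> carrier G \<and> card A \<le> m})"
  define V where "V = {X. X \<subseteq> carrier G \<and> (\<exists>B\<subseteq>carrier G. card B \<le> b \<and>
    m \<le> 4 * card (B <#>\<^bsub>G\<^esub> B) \<and> B <#>\<^bsub>G\<^esub> B \<subseteq> X)}"
  have "{X. X \<subseteq> carrier G \<and> union_of_at_most_sumsets G k X} \<subseteq> V \<union> U"
  proof
    fix X assume "X \<in> {X. X \<subseteq> carrier G \<and> union_of_at_most_sumsets G k X}"
    then have X: "X \<subseteq> carrier G" "union_of_at_most_sumsets G (int (nat k)) X" "1 \<le> nat k"
      using True by auto
    then show "X \<in> V \<union> U"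
    proof (cases rule: union_of_at_most_sumsets_cases[where s = m])
      case small
      then show ?thesis by (simp add: U_def)
    next
      case (large A)
      obtain B where B: "B \<subseteq> A" "card B \<le> b" "m \<le> 4 * card (B <#>\<^bsub>G\<^esub> B)"
        using exists_small_subset_large_product_set[of A m b] large mb m by auto
      moreover have "B <#>\<^bsub>G\<^esub> B \<subseteq> X"
        using B(1) large(3) by (auto simp: set_mult_def)
      ultimately show ?thesis using X large(1) unfolding V_def by blast
    qed
  qed
  moreover have "finite V" "finite U"
    using assms(2) by (auto simp: V_def U_def intro!: finite_PiE)
  ultimately have "card {X. X \<subseteq> carrier G \<and> union_of_at_most_sumsets G k X} \<le> card V + card U"
    by (meson card_Un_le card_mono finite_UnI order_trans)
  then have "real (card {X. X \<subseteq> carrier G \<and> union_of_at_most_sumsets G k X})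
      \<le> real (card V) + real (card U)"
    by linarith
  also have "real (card V) \<le> 2 powr (real N - real_of_int s / 8)"
  proof -
    \<comment> \<open>The constant 64 enters here: it gives
      \<open>N ^ b \<le> 2 powr (m / 8)\<close>, so choosing \<open>B\<close> costs only half of the
      saving \<open>m / 4\<close> in the exponent.\<close>
    have "(8 * log 2 (real N))\<^sup>2 \<le> real m" using assms(4) m by (simp add: power_mult_distrib)
    then have "8 * log 2 (real N) \<le> sqrt (real m)" by (rule real_le_rsqrt)
    then have "real b * (8 * log 2 (real N)) \<le> sqrt (real m) * sqrt (real m)"
      using b_le log1 by (intro mult_mono) auto
    then have bl: "real b * log 2 (real N) \<le> real m / 8" by simp
    have "real N ^ b = 2 powr (log 2 (real N) * real b)"
      using N2 by (simp add: powr_realpow flip: powr_powr)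
    also have "\<dots> \<le> 2 powr (real m / 8)" using bl by (simp add: mult.commute)
    finally have "real N ^ b * 2 powr (real N - real m / 4)
        \<le> 2 powr (real m / 8) * 2 powr (real N - real m / 4)"
      by (rule mult_right_mono) simp
    also have "\<dots> = 2 powr (real N - real_of_int s / 8)"
      using m by (simp flip: powr_add)
    finally show ?thesis
      using card_supersets_of_large_product_sets_le[OF assms(2), of m b] m assms(3)
      by (simp add: V_def)
  qed
  also have "real (card U) \<le> exp (real N / 2)"
  proof -
    have "real (card U) \<le> exp (real (nat k) * (real m * L))"
      using card_unions_of_small_product_sets_le[OF assms(2), of m "nat k"] m assms(3)
      by (simp add: U_def L_def)
    also have "\<dots> \<le> exp (real N / 2)" using kL m True by simp
    finally show ?thesis .
  qed
  finally show ?thesis by simp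
qed

end
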